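(* Let $B$ be a finite skew brace. Then every Carter subbrace of $B$ is a maximal centrally nilpotent subbrace of $B$; that is, if $C$ is a Carter subbrace of $B$ and $A$ is a centrally nilpotent subbrace of $B$ with $C\subseteq A$, then $A=C$.
   Context: A skew (left) brace is a set $B$ with two group operations $(B,+)$ and $(B,\cdot)$ (neither assumed commutative) such that $a(b+c)=ab-a+ac$ for all $a,b,c\in B$; the two groups share the same identity $0$. The lambda map is $\lambda\colon (B,\cdot)\to\mathrm{Aut}(B,+)$, $\lambda_a(b)=-a+ab$. A subbrace of $B$ is a subset that is a subgroup of both $(B,+)$ and $(B,\cdot)$. An ideal of $B$ is a subbrace $I$ with $\lambda_b(I)\subseteq I$ for all $b\in B$ that is normal in both $(B,+)$ and $(B,\cdot)$; one can form the quotient skew brace by an ideal. $Z(B)=\ker\lambda\cap Z(B,+)\cap Z(B,\cdot)$ is an ideal of $B$. Put $Z_1(B)=Z(B)$ and $Z_{n+1}(B)/Z_n(B)=Z(B/Z_n(B))$. $B$ is centrally nilpotent if $Z_n(B)=B$ for some $n\ge 1$. A subbrace $C$ of $B$ is self-idealising in $B$ if it is not an ideal of any subbrace of $B$ strictly containing $C$. A Carter subbrace of $B$ is a centrally nilpotent, self-idealising subbrace of $B$. *)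

theory Defs
  imports "HOL-Algebra.AbelCoset"
begin

text \<open>
  A skew brace is carried by a record of type \<^typ>\<open>('a, 'b) ring_scheme\<close>, which
  provides exactly one carrier, a multiplicative structure and an additive structure
  \<^term>\<open>add_monoid B\<close>.  Neither group is assumed commutative, so the order of
  summands matters throughout.  That \<open>\<one> = \<zero>\<close> is a consequence, see
  \<open>one_eq_zero\<close> below.
\<close>

locale skew_brace =
  fixes B (structure)
  assumes mult_group: "group B"
    and add_group: "group (add_monoid B)"
    and brace_distrib:
      "\<lbrakk>a \<in> carrier B; b \<in> carrier B; c \<in> carrier B\<rbrakk>
        \<Longrightarrow> a \<otimes> (b \<oplus> c) = (a \<otimes> b) \<oplus> (\<ominus> a) \<oplus> (a \<otimes> c)"

definition brace_lambda :: "('a, 'b) ring_scheme \<Rightarrow> 'a \<Rightarrow> 'a \<Rightarrow> 'a" where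
  "brace_lambda B a b = (\<ominus>\<^bsub>B\<^esub> a) \<oplus>\<^bsub>B\<^esub> (a \<otimes>\<^bsub>B\<^esub> b)"

text \<open>
  A subbrace \<open>C\<close> of \<open>B\<close>, regarded as a skew brace in its own right, is
  \<^term>\<open>B\<lparr>carrier := C\<rparr>\<close>.
\<close>

definition subbrace :: "'a set \<Rightarrow> ('a, 'b) ring_scheme \<Rightarrow> bool" where
  "subbrace C B \<longleftrightarrow> subgroup C (add_monoid B) \<and> subgroup C B"

definition brace_ideal :: "'a set \<Rightarrow> ('a, 'b) ring_scheme \<Rightarrow> bool" where
  "brace_ideal I B \<longleftrightarrow>
     subbrace I B \<and>
     (\<forall>b\<in>carrier B. brace_lambda B b ` I \<subseteq> I) \<and>
     I \<lhd> add_monoid B \<and> I \<lhd> B"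

text \<open>
  For an ideal \<open>I\<close> the additive and the multiplicative cosets of \<open>I\<close> agree
  (\<open>ideal_cosets_eq\<close> below), so that both group structures of the quotient are the
  usual elementwise operations on the same set of cosets.
\<close>

definition brace_quot :: "('a, 'b) ring_scheme \<Rightarrow> 'a set \<Rightarrow> 'a set ring" where
  "brace_quot B I =
     \<lparr>carrier = a_rcosets\<^bsub>B\<^esub> I, mult = set_mult B, one = I, zero = I, add = set_add B\<rparr>"

definition group_centre :: "('a, 'b) monoid_scheme \<Rightarrow> 'a set" where
  "group_centre G = {z \<in> carrier G. \<forall>x\<in>carrier G. z \<otimes>\<^bsub>G\<^esub> x = x \<otimes>\<^bsub>G\<^esub> z}"

definition lambda_kernel :: "('a, 'b) ring_scheme \<Rightarrow> 'a set" where
  "lambda_kernel B = {a \<in> carrier B. \<forall>b\<in>carrier B. brace_lambda B a b = b}"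

definition brace_centre :: "('a, 'b) ring_scheme \<Rightarrow> 'a set" where
  "brace_centre B = lambda_kernel B \<inter> group_centre (add_monoid B) \<inter> group_centre B"

text \<open>
  \<open>Z\<^sub>n\<^sub>+\<^sub>1(B)\<close> is the preimage of the centre of the quotient of \<open>B\<close> by
  \<open>Z\<^sub>n(B)\<close> under the canonical projection.  The value at \<open>0\<close> is only a
  convention; central nilpotency quantifies over \<open>n \<ge> 1\<close>.
\<close>

fun upper_central :: "('a, 'b) ring_scheme \<Rightarrow> nat \<Rightarrow> 'a set" where
  "upper_central B 0 = {\<zero>\<^bsub>B\<^esub>}"
| "upper_central B (Suc 0) = brace_centre B"
| "upper_central B (Suc (Suc n)) =
     {b \<in> carrier B. upper_central B (Suc n) +>\<^bsub>B\<^esub> b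
                       \<in> brace_centre (brace_quot B (upper_central B (Suc n)))}"

definition centrally_nilpotent :: "('a, 'b) ring_scheme \<Rightarrow> bool" where
  "centrally_nilpotent B \<longleftrightarrow> (\<exists>n\<ge>1. upper_central B n = carrier B)"

definition self_idealising :: "'a set \<Rightarrow> ('a, 'b) ring_scheme \<Rightarrow> bool" where
  "self_idealising C B \<longleftrightarrow>
     \<not> (\<exists>D. subbrace D B \<and> C \<subset> D \<and> brace_ideal C (B\<lparr>carrier := D\<rparr>))"

definition carter_subbrace :: "'a set \<Rightarrow> ('a, 'b) ring_scheme \<Rightarrow> bool" where
  "carter_subbrace C B \<longleftrightarrow>
     subbrace C B \<and> centrally_nilpotent (B\<lparr>carrier := C\<rparr>) \<and> self_idealising C B"

definition maximal_centrally_nilpotent_subbrace ::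
    "'a set \<Rightarrow> ('a, 'b) ring_scheme \<Rightarrow> bool" where
  "maximal_centrally_nilpotent_subbrace C B \<longleftrightarrow>
     subbrace C B \<and> centrally_nilpotent (B\<lparr>carrier := C\<rparr>) \<and>
     (\<forall>A. subbrace A B \<and> centrally_nilpotent (B\<lparr>carrier := A\<rparr>) \<and> C \<subseteq> A \<longrightarrow> A = C)"

context skew_brace
begin

sublocale M: group B by (rule mult_group)

sublocale A: group "add_monoid B"
  rewrites "carrier (add_monoid B) = carrier B"
    and "mult (add_monoid B) = add B"
    and "one (add_monoid B) = zero B"
    and "m_inv (add_monoid B) = a_inv B"
  by (rule add_group) (simp_all add: a_inv_def)

lemma one_eq_zero: "\<one> = \<zero>"
proof -
  have "\<one> \<otimes> (\<one> \<oplus> \<zero>) = (\<one> \<otimes> \<one>) \<oplus> (\<ominus> \<one>) \<oplus> (\<one> \<otimes> \<zero>)"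
    by (rule brace_distrib) auto
  then have "\<one> = \<one> \<oplus> (\<ominus> \<one>) \<oplus> \<zero>" by simp
  then show ?thesis by simp
qed

lemma subbrace_is_skew_brace:
  assumes "subbrace C B"
  shows "skew_brace (B\<lparr>carrier := C\<rparr>)"
proof (rule skew_brace.intro)
  have s: "subgroup C (add_monoid B)" "subgroup C B"
    using assms by (auto simp: subbrace_def)
  show "group (B\<lparr>carrier := C\<rparr>)"
    using M.subgroup_imp_group[OF s(2)] .
  have e: "add_monoid (B\<lparr>carrier := C\<rparr>) = (add_monoid B)\<lparr>carrier := C\<rparr>" by simp
  show "group (add_monoid (B\<lparr>carrier := C\<rparr>))"
    unfolding e using group.subgroup_imp_group[OF add_group s(1)] by simp
  fix a b c
  assume abc: "a \<in> carrier (B\<lparr>carrier := C\<rparr>)" "b \<in> carrier (B\<lparr>carrier := C\<rparr>)"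
    "c \<in> carrier (B\<lparr>carrier := C\<rparr>)"
  have i: "\<ominus>\<^bsub>B\<lparr>carrier := C\<rparr>\<^esub> a = \<ominus> a"
    using group.m_inv_consistent[OF add_group s(1), of a] abc by (simp add: a_inv_def)
  show "a \<otimes>\<^bsub>B\<lparr>carrier := C\<rparr>\<^esub> (b \<oplus>\<^bsub>B\<lparr>carrier := C\<rparr>\<^esub> c)
      = (a \<otimes>\<^bsub>B\<lparr>carrier := C\<rparr>\<^esub> b) \<oplus>\<^bsub>B\<lparr>carrier := C\<rparr>\<^esub>
        (\<ominus>\<^bsub>B\<lparr>carrier := C\<rparr>\<^esub> a) \<oplus>\<^bsub>B\<lparr>carrier := C\<rparr>\<^esub> (a \<otimes>\<^bsub>B\<lparr>carrier := C\<rparr>\<^esub> c)"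
    unfolding i using abc s(2) by (simp add: brace_distrib subgroup.mem_carrier)
qed

lemma mult_eq_lambda:
  assumes "a \<in> carrier B" "b \<in> carrier B"
  shows "a \<otimes> b = a \<oplus> brace_lambda B a b"
  using assms by (simp add: brace_lambda_def A.m_assoc[symmetric])

lemma lambda_mult:
  assumes "a \<in> carrier B" "b \<in> carrier B" "c \<in> carrier B"
  shows "brace_lambda B (a \<otimes> b) c = brace_lambda B a (brace_lambda B b c)"
proof -
  let ?l = "brace_lambda B b c"
  have l: "?l \<in> carrier B" using assms by (simp add: brace_lambda_def)
  have "(a \<otimes> b) \<otimes> c = a \<otimes> (b \<oplus> ?l)"
    using assms by (simp add: M.m_assoc mult_eq_lambda[symmetric])
  also have "\<dots> = (a \<otimes> b) \<oplus> (\<ominus> a \<oplus> (a \<otimes> ?l))"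
    using assms l by (simp add: brace_distrib A.m_assoc)
  finally show ?thesis
    using assms l unfolding brace_lambda_def by (simp add: A.m_assoc[symmetric])
qed

lemma ideal_cosets_eq:
  assumes I: "brace_ideal I B" and a: "a \<in> carrier B"
  shows "I +> a = I #> a"
proof -
  have n: "I \<lhd> add_monoid B" "I \<lhd> B" and s: "I \<subseteq> carrier B"
    and lam: "\<And>b x. b \<in> carrier B \<Longrightarrow> x \<in> I \<Longrightarrow> brace_lambda B b x \<in> I"
    using I subgroup.subset by (fastforce simp: brace_ideal_def subbrace_def)+
  have "I +> a = (\<Union>x\<in>I. {a \<oplus> x})"
    using normal.coset_eq[OF n(1)] a by (simp add: a_r_coset_def l_coset_def)
  moreover have "I #> a = (\<Union>x\<in>I. {a \<otimes> x})"
    using normal.coset_eq[OF n(2)] a by (simp add: l_coset_def)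
  moreover have "a \<otimes> x \<in> (\<Union>x\<in>I. {a \<oplus> x})" if "x \<in> I" for x
    using that mult_eq_lambda[of a x] lam[of a x] a s by auto
  moreover have "a \<oplus> x \<in> (\<Union>x\<in>I. {a \<otimes> x})" if x: "x \<in> I" for x
  proof -
    let ?y = "brace_lambda B (inv a) x"
    have xc: "x \<in> carrier B" and y: "?y \<in> I" "?y \<in> carrier B"
      using a x s lam[of "inv a" x] by auto
    have "brace_lambda B a ?y = brace_lambda B \<one> x"
      using a xc by (simp add: lambda_mult[symmetric])
    also have "\<dots> = \<ominus> \<zero> \<oplus> x"
      using xc by (simp add: brace_lambda_def flip: one_eq_zero)
    also have "\<dots> = x" using xc by simp
    finally have "a \<otimes> ?y = a \<oplus> x" using a y by (simp add: mult_eq_lambda)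
    then show ?thesis using y by force
  qed
  ultimately show ?thesis by auto
qed

lemma brace_quot_is_skew_brace:
  assumes I: "brace_ideal I B"
  shows "skew_brace (brace_quot B I)"
proof -
  let ?Q = "brace_quot B I"
  have n: "I \<lhd> add_monoid B" "I \<lhd> B"
    using I by (auto simp: brace_ideal_def)
  have cos: "a_rcosets I = rcosets I"
    using ideal_cosets_eq[OF I] by (auto simp: A_RCOSETS_def RCOSETS_def a_r_coset_def)
  have M: "group ?Q"
  proof -
    have "group (B Mod I)" using normal.factorgroup_is_group[OF n(2)] .
    then show ?thesis
      unfolding group_def monoid_def group_axioms_def Units_def
      by (simp add: FactGroup_def brace_quot_def cos)
  qed
  have eA: "add_monoid ?Q = add_monoid B Mod I"
    by (simp add: brace_quot_def FactGroup_def A_RCOSETS_def set_add_def)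
  have A: "group (add_monoid ?Q)"
    unfolding eA using normal.factorgroup_is_group[OF n(1)] .
  have add: "(I +> a) \<oplus>\<^bsub>?Q\<^esub> (I +> b) = I +> (a \<oplus> b)"
    if "a \<in> carrier B" "b \<in> carrier B" for a b
    using normal.rcos_sum[OF n(1)] that
    by (simp add: brace_quot_def set_add_def a_r_coset_def)
  have mult: "(I +> a) \<otimes>\<^bsub>?Q\<^esub> (I +> b) = I +> (a \<otimes> b)"
    if "a \<in> carrier B" "b \<in> carrier B" for a b
    using normal.rcos_sum[OF n(2)] that by (simp add: brace_quot_def ideal_cosets_eq[OF I])
  have inv: "\<ominus>\<^bsub>?Q\<^esub> (I +> a) = I +> (\<ominus> a)" if "a \<in> carrier B" for a
  proof -
    have "I #>\<^bsub>add_monoid B\<^esub> a \<in> carrier (add_monoid B Mod I)"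
      using that by (auto simp: FactGroup_def RCOSETS_def)
    then show ?thesis
      unfolding a_inv_def eA a_r_coset_def
      using normal.inv_FactGroup[OF n(1)] normal.rcos_inv[OF n(1)] that by simp
  qed
  show ?thesis
  proof (rule skew_brace.intro)
    show "group ?Q" by (rule M)
    show "group (add_monoid ?Q)" by (rule A)
    fix x y z assume "x \<in> carrier ?Q" "y \<in> carrier ?Q" "z \<in> carrier ?Q"
    then obtain a b c where abc: "a \<in> carrier B" "b \<in> carrier B" "c \<in> carrier B"
      and "x = I +> a" "y = I +> b" "z = I +> c"
      by (auto simp: brace_quot_def A_RCOSETS_def RCOSETS_def a_r_coset_def)
    then show "x \<otimes>\<^bsub>?Q\<^esub> (y \<oplus>\<^bsub>?Q\<^esub> z)
        = (x \<otimes>\<^bsub>?Q\<^esub> y) \<oplus>\<^bsub>?Q\<^esub> (\<ominus>\<^bsub>?Q\<^esub> x) \<oplus>\<^bsub>?Q\<^esub> (x \<otimes>\<^bsub>?Q\<^esub> z)"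
      by (simp add: add mult inv brace_distrib)
  qed
qed

end

end

theory Submission
  imports Defs "HOL-Algebra.Zassenhaus"
begin

text \<open>
  The result is the normaliser condition for nilpotent groups, carried over to skew
  braces: in a centrally nilpotent skew brace \<open>A\<close>, no proper subbrace \<open>C\<close> is
  self-idealising.  A Carter subbrace stays self-idealising in every subbrace
  containing it, because a subbrace of that subbrace is one of the whole brace; so if that subbrace is centrally nilpotent, the two coincide.

  For the normaliser condition, suppose that \<open>Z\<^sub>n(A) \<subseteq> C\<close> and let
  \<open>J = Z\<^sub>n\<^sub>+\<^sub>1(A)\<close>.  Modulo \<open>Z\<^sub>n(A)\<close> an element \<open>j\<close> of \<open>J\<close> is
  central, so it moves an element of \<open>C\<close>, whether by additive conjugation, by
  multiplicative conjugation or by \<open>\<lambda>\<^sub>j\<close>, only within its coset of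
  \<open>Z\<^sub>n(A)\<close>, and that coset lies in \<open>C\<close>.  Since \<open>J\<close> is an ideal,
  \<open>D = J + C\<close> equals \<open>J C\<close> and is a subbrace.  Every \<open>d \<in> D\<close> can therefore be
  written both as a sum and as a product of an element of \<open>J\<close> and one of \<open>C\<close>.
  The sum shows that additive conjugation by \<open>d\<close> preserves \<open>C\<close>, the product that
  multiplicative conjugation and \<open>\<lambda>\<^sub>d\<close> do: thus \<open>C\<close> is an ideal of \<open>D\<close>
  (\<open>ideal_in_saturated_sum\<close>).  If \<open>C\<close> is self-idealising, then \<open>D = C\<close>, hence
  \<open>Z\<^sub>n\<^sub>+\<^sub>1(A) \<subseteq> C\<close>.  Starting from \<open>Z\<^sub>0(A) = 0\<close>, the whole upper central
  series climbs inside \<open>C\<close>, and it reaches \<open>A\<close>.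

  This argument sees the quotient by \<open>Z\<^sub>n(A)\<close> only through its projection, so it is
  carried out for an arbitrary homomorphism \<open>f\<close> of skew braces.  The identity map
  serves for \<open>Z\<^sub>1(A)\<close>, which is defined separately from the later terms, and the
  projection onto a quotient for those.
\<close>

section \<open>The centre of a skew brace and its preimages\<close>

text \<open>
  Centrality in terms of the operations only: \<open>\<lambda>\<^sub>z\<close> is trivial exactly when
  multiplying by \<open>z\<close> from the left is the same as adding it.
\<close>

lemma (in skew_brace) brace_centre_iff:
  "z \<in> brace_centre B \<longleftrightarrow>
     z \<in> carrier B \<and>
     (\<forall>b\<in>carrier B. z \<oplus> b = b \<oplus> z \<and> z \<otimes> b = b \<otimes> z \<and> z \<otimes> b = z \<oplus> b)"
proof -
  have "\<ominus> z \<oplus> (z \<otimes> b) = b \<longleftrightarrow> z \<otimes> b = z \<oplus> b" if "z \<in> carrier B" "b \<in> carrier B" for b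
    using that A.inv_solve_left[of b z "z \<otimes> b"] by auto
  then show ?thesis
    by (auto simp: brace_centre_def lambda_kernel_def group_centre_def brace_lambda_def)
qed

text \<open>
  On the centre the two operations and the two inverses agree, so closure under one
  structure gives closure under the other.
\<close>

lemma (in skew_brace) subbrace_brace_centre: "subbrace (brace_centre B) B"
proof -
  let ?Z = "brace_centre B"
  have sub: "?Z \<subseteq> carrier B" by (auto simp: brace_centre_iff)
  have zero_mult: "\<zero> \<otimes> b = b" "b \<otimes> \<zero> = b" if "b \<in> carrier B" for b
    using M.l_one[OF that] M.r_one[OF that] unfolding one_eq_zero .
  have zero: "\<zero> \<in> ?Z"
    unfolding brace_centre_iff by (simp add: zero_mult)
  have eq: "z \<otimes> w = z \<oplus> w" if "z \<in> ?Z" "w \<in> carrier B" for z w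
    using that unfolding brace_centre_iff by blast
  have add: "z \<oplus> w \<in> ?Z" if zw: "z \<in> ?Z" "w \<in> ?Z" for z w
  proof -
    have c: "z \<in> carrier B" "w \<in> carrier B" using zw sub by auto
    have "z \<oplus> w \<oplus> b = b \<oplus> (z \<oplus> w) \<and> (z \<oplus> w) \<otimes> b = b \<otimes> (z \<oplus> w)
      \<and> (z \<oplus> w) \<otimes> b = z \<oplus> w \<oplus> b" if b: "b \<in> carrier B" for b
    proof -
      have 1: "z \<oplus> b = b \<oplus> z" "w \<oplus> b = b \<oplus> w" "z \<otimes> b = b \<otimes> z" "w \<otimes> b = b \<otimes> w"
        using zw b by (auto simp: brace_centre_iff)
      have "z \<oplus> w \<oplus> b = z \<oplus> (b \<oplus> w)"
        using c b by (simp add: A.m_assoc 1(2))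
      also have "\<dots> = b \<oplus> z \<oplus> w"
        using c b by (simp add: A.m_assoc[symmetric] 1(1))
      finally have A: "z \<oplus> w \<oplus> b = b \<oplus> (z \<oplus> w)"
        using c b by (simp add: A.m_assoc)
      have "z \<otimes> w \<otimes> b = z \<otimes> (b \<otimes> w)"
        using c b by (simp add: M.m_assoc 1(4))
      also have "\<dots> = b \<otimes> z \<otimes> w"
        using c b by (simp add: M.m_assoc[symmetric] 1(3))
      finally have M: "(z \<oplus> w) \<otimes> b = b \<otimes> (z \<oplus> w)"
        using c b by (simp add: M.m_assoc eq[OF zw(1) c(2), symmetric])
      have "(z \<oplus> w) \<otimes> b = z \<otimes> (w \<otimes> b)"
        using c b by (simp add: M.m_assoc eq[OF zw(1) c(2), symmetric])
      also have "\<dots> = z \<oplus> w \<oplus> b"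
        using c b zw by (simp add: eq A.m_assoc)
      finally show ?thesis using A M by simp
    qed
    then show ?thesis using A.m_closed[OF c] unfolding brace_centre_iff by blast
  qed
  have inv: "\<ominus> z \<in> ?Z" "inv z = \<ominus> z" if z: "z \<in> ?Z" for z
  proof -
    have c: "z \<in> carrier B" using z sub by auto
    have "\<ominus> z \<otimes> z = \<one>"
      using z c by (metis A.inv_closed A.r_inv brace_centre_iff one_eq_zero)
    then show e: "inv z = \<ominus> z" using c by (simp add: M.inv_equality)
    have "\<ominus> z \<oplus> b = b \<oplus> \<ominus> z \<and> inv z \<otimes> b = b \<otimes> inv z \<and> inv z \<otimes> b = \<ominus> z \<oplus> b"
      if b: "b \<in> carrier B" for b
    proof -
      have 1: "z \<oplus> b = b \<oplus> z" "z \<otimes> b = b \<otimes> z"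
        using z b by (auto simp: brace_centre_iff)
      have "\<ominus> z \<oplus> b = b \<oplus> \<ominus> z"
        using 1 c b by (metis A.inv_closed A.inv_solve_left' A.inv_solve_right' A.m_assoc A.m_closed)
      moreover have "inv z \<otimes> b = b \<otimes> inv z"
        using 1 c b by (metis M.inv_closed M.inv_solve_left' M.inv_solve_right' M.m_assoc M.m_closed)
      moreover have "z \<otimes> (\<ominus> z \<oplus> b) = b"
        using c b z by (simp add: eq A.m_assoc[symmetric])
      then have "inv z \<otimes> b = \<ominus> z \<oplus> b"
        using c b by (simp add: M.inv_solve_left')
      ultimately show ?thesis by simp
    qed
    then show "\<ominus> z \<in> ?Z" using A.inv_closed[OF c] unfolding brace_centre_iff e by blast
  qed
  show ?thesis
    unfolding subbrace_def
  proof
    show "subgroup ?Z (add_monoid B)"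
      using sub zero add inv by (auto intro!: A.subgroupI)
    show "subgroup ?Z B"
      using sub zero add inv by (auto intro!: M.subgroupI simp: eq subset_iff)
  qed
qed

text \<open>
  Used for both group structures to show that \<open>C\<close> is normal in a subbrace \<open>D\<close>, by
  computing conjugates in the ambient group.
\<close>

lemma (in group) conj_closed_imp_normal_restrict:
  assumes "subgroup C G" "subgroup D G" "C \<subseteq> D"
    and "\<And>d x. d \<in> D \<Longrightarrow> x \<in> C \<Longrightarrow> d \<otimes> x \<otimes> inv d \<in> C"
  shows "C \<lhd> G\<lparr>carrier := D\<rparr>"
  using assms
  by (simp add: group.normal_inv_iff subgroup_imp_group subgroup_incl m_inv_consistent)

locale skew_brace_hom = B: skew_brace B + Q: skew_brace Q
  for B :: "('a, 'b) ring_scheme" (structure) and Q :: "('c, 'd) ring_scheme" and f +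
  assumes closed: "x \<in> carrier B \<Longrightarrow> f x \<in> carrier Q"
    and add: "\<lbrakk>x \<in> carrier B; y \<in> carrier B\<rbrakk> \<Longrightarrow> f (x \<oplus> y) = f x \<oplus>\<^bsub>Q\<^esub> f y"
    and mult: "\<lbrakk>x \<in> carrier B; y \<in> carrier B\<rbrakk> \<Longrightarrow> f (x \<otimes> y) = f x \<otimes>\<^bsub>Q\<^esub> f y"
begin

lemma f_zero: "f \<zero> = \<zero>\<^bsub>Q\<^esub>"
  using add[of \<zero> \<zero>] closed[of \<zero>] by simp

lemma f_one: "f \<one> = \<one>\<^bsub>Q\<^esub>"
  using f_zero by (simp add: B.one_eq_zero Q.one_eq_zero)

lemma f_a_inv: "x \<in> carrier B \<Longrightarrow> f (\<ominus> x) = \<ominus>\<^bsub>Q\<^esub> f x"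
  using add[of "\<ominus> x" x] closed f_zero by (intro Q.A.inv_equality[symmetric]) auto

lemma f_inv: "x \<in> carrier B \<Longrightarrow> f (inv x) = inv\<^bsub>Q\<^esub> f x"
  using mult[of "inv x" x] closed f_one by (intro Q.M.inv_equality[symmetric]) auto

abbreviation centre_preimage :: "'a set" where
  "centre_preimage \<equiv> {b \<in> carrier B. f b \<in> brace_centre Q}"

text \<open>
  The next three lemmas hold because \<open>f x\<close> and \<open>f y\<close> commute for both operations
  and have equal sum and product once one of them is central.  With \<open>y\<close> central they
  show that the preimage of the centre is an ideal; with \<open>x\<close> central they bound how
  far that preimage moves the elements of a subbrace.
\<close>

lemma image_conj_add_central:
  assumes "x \<in> carrier B" "y \<in> carrier B" "f x \<in> brace_centre Q \<or> f y \<in> brace_centre Q"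
  shows "f (x \<oplus> y \<oplus> \<ominus> x) = f y"
proof -
  have "f x \<oplus>\<^bsub>Q\<^esub> f y = f y \<oplus>\<^bsub>Q\<^esub> f x"
    using assms closed by (auto simp: Q.brace_centre_iff)
  then show ?thesis
    using assms closed by (simp add: add f_a_inv Q.A.m_assoc)
qed

lemma image_conj_mult_central:
  assumes "x \<in> carrier B" "y \<in> carrier B" "f x \<in> brace_centre Q \<or> f y \<in> brace_centre Q"
  shows "f (x \<otimes> y \<otimes> inv x) = f y"
proof -
  have "f x \<otimes>\<^bsub>Q\<^esub> f y = f y \<otimes>\<^bsub>Q\<^esub> f x"
    using assms closed by (auto simp: Q.brace_centre_iff)
  then show ?thesis
    using assms closed by (simp add: mult f_inv Q.M.m_assoc)
qed

lemma image_lambda_central: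
  assumes "x \<in> carrier B" "y \<in> carrier B" "f x \<in> brace_centre Q \<or> f y \<in> brace_centre Q"
  shows "f (brace_lambda B x y) = f y"
proof -
  have "f x \<otimes>\<^bsub>Q\<^esub> f y = f x \<oplus>\<^bsub>Q\<^esub> f y"
    using assms closed by (metis Q.brace_centre_iff)
  then show ?thesis
    using assms closed
    by (simp add: brace_lambda_def add mult f_a_inv Q.A.m_assoc[symmetric])
qed

lemma brace_ideal_centre_preimage: "brace_ideal centre_preimage B"
proof -
  let ?J = centre_preimage
  have Z: "subgroup (brace_centre Q) (add_monoid Q)" "subgroup (brace_centre Q) Q"
    using Q.subbrace_brace_centre by (auto simp: subbrace_def)
  have "\<zero>\<^bsub>Q\<^esub> \<in> brace_centre Q" using subgroup.one_closed[OF Z(1)] by simp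
  then have ne: "?J \<noteq> {}" using B.A.one_closed f_zero by force
  have sA: "subgroup ?J (add_monoid B)"
    using ne subgroup.m_closed[OF Z(1)] subgroup.m_inv_closed[OF Z(1)]
    by (intro B.A.subgroupI) (auto simp: add f_a_inv simp flip: a_inv_def)
  have sM: "subgroup ?J B"
    using ne subgroup.m_closed[OF Z(2)] subgroup.m_inv_closed[OF Z(2)]
    by (intro B.M.subgroupI) (auto simp: mult f_inv)
  have "?J \<lhd> add_monoid B"
    using B.A.normal_invI[OF sA] by (simp add: image_conj_add_central)
  moreover have "?J \<lhd> B"
    using B.M.normal_invI[OF sM] by (simp add: image_conj_mult_central)
  moreover have "brace_lambda B b j \<in> ?J" if "b \<in> carrier B" "j \<in> ?J" for b j
    using that image_lambda_central[of b j] by (simp add: brace_lambda_def)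
  ultimately show ?thesis
    using sA sM by (auto simp: brace_ideal_def subbrace_def)
qed

text \<open>
  Elements of the centre preimage act on \<open>C\<close> within the fibres of \<open>f\<close>, and the
  saturation hypothesis says that \<open>C\<close> is a union of such fibres; so adjoining the
  centre preimage to \<open>C\<close> keeps \<open>C\<close> an ideal.
\<close>

lemma ideal_in_saturated_sum:
  assumes C: "subbrace C B"
    and saturated: "{u \<in> carrier B. f u \<in> f ` C} \<subseteq> C"
  defines "D \<equiv> set_add B centre_preimage C"
  shows "subbrace D B" "C \<subseteq> D" "centre_preimage \<subseteq> D" "brace_ideal C (B\<lparr>carrier := D\<rparr>)"
proof -
  let ?J = centre_preimage
  have sat: "u \<in> C" if "x \<in> C" "u \<in> carrier B" "f u = f x" for x u
    using saturated that by force
  have J: "brace_ideal ?J B" by (rule brace_ideal_centre_preimage)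
  then have nJ: "?J \<lhd> add_monoid B" "?J \<lhd> B" by (auto simp: brace_ideal_def)
  have sC: "subgroup C (add_monoid B)" "subgroup C B"
    using C by (auto simp: subbrace_def)
  have cC: "C \<subseteq> carrier B" using subgroup.subset[OF sC(2)] .
  have DA: "D = ?J <#>\<^bsub>add_monoid B\<^esub> C" by (simp add: D_def set_add_def)
  \<comment> \<open>The sum is also the set product, as both are unions of cosets of the ideal \<open>J\<close>.\<close>
  have "D = (\<Union>c\<in>C. ?J +> c)"
    by (auto simp: DA set_mult_def a_r_coset_def r_coset_def)
  also have "\<dots> = (\<Union>c\<in>C. ?J #> c)"
    using B.ideal_cosets_eq[OF J] cC by (intro SUP_cong) auto
  also have "\<dots> = ?J <#> C"
    by (auto simp: set_mult_def r_coset_def)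
  finally have DM: "D = ?J <#> C" .
  have sD: "subgroup D (add_monoid B)" "subgroup D B"
    using B.A.mult_norm_subgroup[OF nJ(1) sC(1)] B.M.mult_norm_subgroup[OF nJ(2) sC(2)]
    by (simp_all flip: DA DM)
  then show D: "subbrace D B" by (simp add: subbrace_def)
  have one: "\<one> \<in> C" "\<one> \<in> ?J"
    using subgroup.one_closed[OF sC(2)] subgroup.one_closed[OF normal_imp_subgroup[OF nJ(2)]]
    by auto
  show CD: "C \<subseteq> D"
    unfolding DM set_mult_def using one(2) cC by (force intro: bexI[of _ \<one>])
  show "?J \<subseteq> D"
    unfolding DM set_mult_def using one(1) by (force intro: bexI[of _ \<one>])
  \<comment> \<open>In each of the three closure properties the \<open>C\<close>-part of \<open>d\<close> acts first and stays
      in \<open>C\<close>; the \<open>J\<close>-part then stays in the same fibre of \<open>f\<close>.\<close>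
  have conjA: "d \<oplus> x \<oplus> \<ominus> d \<in> C" if "d \<in> D" "x \<in> C" for d x
  proof -
    obtain j c where j: "j \<in> ?J" and c: "c \<in> C" and d: "d = j \<oplus> c"
      using \<open>d \<in> D\<close> by (auto simp: DA set_mult_def)
    let ?y = "c \<oplus> x \<oplus> \<ominus> c"
    have y: "?y \<in> C"
      using c that subgroup.m_closed[OF sC(1)] subgroup.m_inv_closed[OF sC(1)]
      by (simp add: a_inv_def)
    have cc: "j \<in> carrier B" "c \<in> carrier B" "x \<in> carrier B" using j c that cC by auto
    have "d \<oplus> x \<oplus> \<ominus> d = j \<oplus> ?y \<oplus> \<ominus> j"
      using cc by (simp add: d B.A.m_assoc B.A.inv_mult_group)
    moreover have "j \<oplus> ?y \<oplus> \<ominus> j \<in> C"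
      using j cc by (intro sat[OF y]) (simp_all add: image_conj_add_central)
    ultimately show ?thesis by simp
  qed
  have conjM: "d \<otimes> x \<otimes> inv d \<in> C" if "d \<in> D" "x \<in> C" for d x
  proof -
    obtain j c where j: "j \<in> ?J" and c: "c \<in> C" and d: "d = j \<otimes> c"
      using \<open>d \<in> D\<close> by (auto simp: DM set_mult_def)
    let ?y = "c \<otimes> x \<otimes> inv c"
    have y: "?y \<in> C"
      using c that subgroup.m_closed[OF sC(2)] subgroup.m_inv_closed[OF sC(2)] by simp
    have cc: "j \<in> carrier B" "c \<in> carrier B" "x \<in> carrier B" using j c that cC by auto
    have "d \<otimes> x \<otimes> inv d = j \<otimes> ?y \<otimes> inv j"
      using cc by (simp add: d B.M.m_assoc B.M.inv_mult_group)
    moreover have "j \<otimes> ?y \<otimes> inv j \<in> C"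
      using j cc by (intro sat[OF y]) (simp_all add: image_conj_mult_central)
    ultimately show ?thesis by simp
  qed
  have lam: "brace_lambda B d x \<in> C" if "d \<in> D" "x \<in> C" for d x
  proof -
    obtain j c where j: "j \<in> ?J" and c: "c \<in> C" and d: "d = j \<otimes> c"
      using \<open>d \<in> D\<close> by (auto simp: DM set_mult_def)
    let ?y = "brace_lambda B c x"
    have y: "?y \<in> C"
      using c that subgroup.m_closed[OF sC(1)] subgroup.m_inv_closed[OF sC(1)]
        subgroup.m_closed[OF sC(2)]
      by (simp add: brace_lambda_def a_inv_def)
    have cc: "j \<in> carrier B" "c \<in> carrier B" "x \<in> carrier B" "?y \<in> carrier B"
      using j c that cC y by auto
    have "brace_lambda B d x = brace_lambda B j ?y"
      using cc by (simp add: d B.lambda_mult)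
    moreover have "brace_lambda B j ?y \<in> C"
      using j cc by (intro sat[OF y]) (simp_all add: image_lambda_central, simp add: brace_lambda_def)
    ultimately show ?thesis by simp
  qed
  have "C \<lhd> add_monoid B\<lparr>carrier := D\<rparr>"
    using B.A.conj_closed_imp_normal_restrict[OF sC(1) sD(1) CD conjA] by simp
  moreover have "C \<lhd> B\<lparr>carrier := D\<rparr>"
    by (rule B.M.conj_closed_imp_normal_restrict[OF sC(2) sD(2) CD conjM])
  moreover have "brace_lambda (B\<lparr>carrier := D\<rparr>) d x = brace_lambda B d x" if "d \<in> D" for d x
    using that B.A.m_inv_consistent[OF sD(1)] by (simp add: brace_lambda_def a_inv_def)
  ultimately show "brace_ideal C (B\<lparr>carrier := D\<rparr>)"
    using lam by (auto simp: brace_ideal_def subbrace_def normal_imp_subgroup)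
qed

end

section \<open>Central nilpotency and the normaliser condition\<close>

context skew_brace
begin

lemma skew_brace_hom_id: "skew_brace_hom B B (\<lambda>x. x)"
  by unfold_locales auto

lemma skew_brace_hom_quot:
  assumes I: "brace_ideal I B"
  shows "skew_brace_hom B (brace_quot B I) (\<lambda>a. I +> a)"
proof -
  have n: "I \<lhd> add_monoid B" "I \<lhd> B"
    using I by (auto simp: brace_ideal_def)
  interpret Q: skew_brace "brace_quot B I" by (rule brace_quot_is_skew_brace[OF I])
  show ?thesis
  proof unfold_locales
    fix x y assume xy: "x \<in> carrier B" "y \<in> carrier B"
    show "I +> (x \<oplus> y) = (I +> x) \<oplus>\<^bsub>brace_quot B I\<^esub> (I +> y)"
      using normal.rcos_sum[OF n(1)] xy
      by (simp add: brace_quot_def set_add_def a_r_coset_def)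
    show "I +> (x \<otimes> y) = (I +> x) \<otimes>\<^bsub>brace_quot B I\<^esub> (I +> y)"
      using normal.rcos_sum[OF n(2)] xy by (simp add: brace_quot_def ideal_cosets_eq[OF I])
  qed (auto simp: brace_quot_def A_RCOSETS_def RCOSETS_def a_r_coset_def)
qed

text \<open>
  Each term has to be an ideal for the quotient that defines the next term to be a skew
  brace.
\<close>

lemma brace_ideal_upper_central: "brace_ideal (upper_central B (Suc n)) B"
proof (induction n)
  case 0
  interpret h: skew_brace_hom B B "\<lambda>x. x" by (rule skew_brace_hom_id)
  have "h.centre_preimage = brace_centre B"
    by (auto simp: brace_centre_def group_centre_def)
  then show ?case using h.brace_ideal_centre_preimage by simp
next
  case (Suc n)
  interpret h: skew_brace_hom B "brace_quot B (upper_central B (Suc n))"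
    "\<lambda>a. upper_central B (Suc n) +> a" by (rule skew_brace_hom_quot[OF Suc])
  show ?case using h.brace_ideal_centre_preimage by simp
qed

lemma next_upper_central_idealises:
  assumes C: "subbrace C B" and le: "upper_central B n \<subseteq> C"
  shows "\<exists>D. subbrace D B \<and> C \<subseteq> D \<and> upper_central B (Suc n) \<subseteq> D
    \<and> brace_ideal C (B\<lparr>carrier := D\<rparr>)"
proof (cases n)
  case 0
  interpret h: skew_brace_hom B B "\<lambda>x. x" by (rule skew_brace_hom_id)
  have "h.centre_preimage = brace_centre B"
    by (auto simp: brace_centre_def group_centre_def)
  then show ?thesis using h.ideal_in_saturated_sum[OF C] 0 by auto
next
  case (Suc m)
  let ?I = "upper_central B n"
  have I: "brace_ideal ?I B" using brace_ideal_upper_central Suc by simp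
  interpret h: skew_brace_hom B "brace_quot B ?I" "\<lambda>a. ?I +> a"
    by (rule skew_brace_hom_quot[OF I])
  have sI: "subgroup ?I (add_monoid B)" and sC: "subgroup C (add_monoid B)"
    using I C by (auto simp: brace_ideal_def subbrace_def)
  have "u \<in> C" if "x \<in> C" "u \<in> carrier B" "?I +> u = ?I +> x" for x u
  proof -
    have "u \<in> ?I +> x"
      using A.rcos_self[OF \<open>u \<in> carrier B\<close> sI] that(3) by (simp add: a_r_coset_def)
    then show ?thesis
      using le that(1) subgroup.m_closed[OF sC] by (auto simp: a_r_coset_def r_coset_def)
  qed
  then have sat: "{u \<in> carrier B. ?I +> u \<in> (\<lambda>a. ?I +> a) ` C} \<subseteq> C" by auto
  have "h.centre_preimage = upper_central B (Suc n)" using Suc by simp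
  then show ?thesis using h.ideal_in_saturated_sum[OF C sat] by auto
qed

text \<open>
  The contrapositive of the normaliser condition lets the terms of the upper central
  series be absorbed into \<open>C\<close> one after the other, by induction.
\<close>

lemma self_idealising_in_centrally_nilpotent:
  assumes "centrally_nilpotent B" "subbrace C B" "self_idealising C B"
  shows "C = carrier B"
proof -
  have "upper_central B n \<subseteq> C" for n
  proof (induction n)
    case 0
    show ?case
      using subgroup.one_closed[of C "add_monoid B"] assms(2) by (simp add: subbrace_def)
  next
    case (Suc n)
    then show ?case
      using next_upper_central_idealises[OF assms(2) Suc] assms(3)
      unfolding self_idealising_def by blast
  qed
  moreover have "C \<subseteq> carrier B"
    using assms(2) by (simp add: subbrace_def subgroup.subset)
  ultimately show ?thesis
    using assms(1) unfolding centrally_nilpotent_def by blast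
qed

lemma subbrace_trans:
  assumes "subbrace A B" "subbrace D (B\<lparr>carrier := A\<rparr>)"
  shows "subbrace D B"
  using assms A.incl_subgroup[of A D] M.incl_subgroup[of A D] by (simp add: subbrace_def)

lemma subbrace_restrict:
  assumes "subbrace A B" "subbrace C B" "C \<subseteq> A"
  shows "subbrace C (B\<lparr>carrier := A\<rparr>)"
  using assms A.subgroup_incl[of C A] M.subgroup_incl[of C A] by (simp add: subbrace_def)

end

theorem proposition4p1:
  fixes B :: "('a, 'b) ring_scheme" and C :: "'a set"
  assumes "skew_brace B"
    and "finite (carrier B)"
    and "carter_subbrace C B"
  shows "maximal_centrally_nilpotent_subbrace C B"
proof -
  interpret skew_brace B by (rule assms)
  have C: "subbrace C B" "centrally_nilpotent (B\<lparr>carrier := C\<rparr>)" "self_idealising C B"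
    using assms(3) by (auto simp: carter_subbrace_def)
  have "A = C"
    if A: "subbrace A B" "centrally_nilpotent (B\<lparr>carrier := A\<rparr>)" "C \<subseteq> A" for A
  proof -
    interpret A: skew_brace "B\<lparr>carrier := A\<rparr>" by (rule subbrace_is_skew_brace[OF A(1)])
    have "self_idealising C (B\<lparr>carrier := A\<rparr>)"
      using C(3) subbrace_trans[OF A(1)] by (auto simp: self_idealising_def)
    then show ?thesis
      using A.self_idealising_in_centrally_nilpotent[OF A(2)] subbrace_restrict[OF A(1) C(1) A(3)]
      by fastforce
  qed
  then show ?thesis
    using C by (simp add: maximal_centrally_nilpotent_subbrace_def)
qed

end
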